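(* Let $E$ be a Banach space such that $FBL[E]$ has the $\lambda$-strong Nakano property for some $\lambda\ge 1$. Then $E$ does not contain a subspace isomorphic to $c_0$.
   Context: All spaces are real. For a Banach space $E$ with dual $E^*$ and closed unit ball $B_E$, a function $f:E^*\to\mathbb R$ is positively homogeneous if $f(\lambda x^* )=\lambda f(x^* )$ for all $\lambda\ge 0$. For such $f$ put $$\|f\|_{FBL[E]}=\sup\Big\{\sum_{i=1}^m|f(x_i^* )| : m\in\mathbb N,\ x_1^*,\dots,x_m^*\in E^*,\ \sup_{x\in B_E}\sum_{i=1}^m|x_i^*(x)|\le 1\Big\}.$$ $H_1[E]$ is the Banach lattice of all positively homogeneous $f:E^*\to\mathbb R$ with $\|f\|_{FBL[E]}<\infty$, with this norm and pointwise order and lattice operations. The free Banach lattice $FBL[E]$ is the closed sublattice of $H_1[E]$ generated by the evaluations $\delta_x$, $x\in E$, where $\delta_x(x^* )=x^*(x)$. For $\lambda\ge 1$, a Banach lattice $X$ has the $\lambda$-strong Nakano property if every norm-bounded (non-empty) upwards directed set $A\subset X_+$ has an upper bound $b\in X$ with $\|b\|\le\lambda\sup\{\|a\|:a\in A\}$. *)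

theory Defs
  imports "HOL-Analysis.Analysis" "HOL-Library.Function_Algebras"
begin

text \<open>
  The dual of \<open>'a\<close> is the type \<open>'a \<Rightarrow>\<^sub>L real\<close>. Functions on the dual carry the pointwise operations of
  \<^theory>\<open>HOL-Library.Function_Algebras\<close> and the library's pointwise order and lattice operations
  on function types.
\<close>

definition pos_homogeneous :: "('v::real_vector \<Rightarrow> real) \<Rightarrow> bool" where
  "pos_homogeneous f \<longleftrightarrow> (\<forall>c\<ge>0. \<forall>x. f (c *\<^sub>R x) = c * f x)"

definition fbl_sums :: "(('a::real_normed_vector \<Rightarrow>\<^sub>L real) \<Rightarrow> real) \<Rightarrow> real set" where
  "fbl_sums f = {(\<Sum>i=1..m. \<bar>f (xs i)\<bar>) | (m::nat) (xs :: nat \<Rightarrow> ('a \<Rightarrow>\<^sub>L real)).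
     (SUP x\<in>cball 0 1. \<Sum>i=1..m. \<bar>blinfun_apply (xs i) x\<bar>) \<le> 1}"

text \<open>
  The supremum is taken in \<^typ>\<open>real\<close> and is meaningful only if \<^term>\<open>bdd_above (fbl_sums f)\<close>,
  which expresses that the norm of \<open>f\<close> is finite.
\<close>

definition fbl_norm :: "(('a::real_normed_vector \<Rightarrow>\<^sub>L real) \<Rightarrow> real) \<Rightarrow> real" where
  "fbl_norm f = Sup (fbl_sums f)"

definition H1 :: "(('a::real_normed_vector \<Rightarrow>\<^sub>L real) \<Rightarrow> real) set" where
  "H1 = {f. pos_homogeneous f \<and> bdd_above (fbl_sums f)}"

definition delta :: "'a::real_normed_vector \<Rightarrow> ('a \<Rightarrow>\<^sub>L real) \<Rightarrow> real" where
  "delta x = (\<lambda>x'. blinfun_apply x' x)"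

definition closed_sublattice_H1 :: "(('a::real_normed_vector \<Rightarrow>\<^sub>L real) \<Rightarrow> real) set \<Rightarrow> bool" where
  "closed_sublattice_H1 S \<longleftrightarrow>
     S \<subseteq> H1 \<and> 0 \<in> S \<and>
     (\<forall>f\<in>S. \<forall>g\<in>S. f + g \<in> S \<and> sup f g \<in> S \<and> inf f g \<in> S) \<and>
     (\<forall>c. \<forall>f\<in>S. (\<lambda>x'. c * f x') \<in> S) \<and>
     (\<forall>g f. (\<forall>n::nat. g n \<in> S) \<and> f \<in> H1 \<and> (\<lambda>n. fbl_norm (g n - f)) \<longlonglongrightarrow> 0 \<longrightarrow> f \<in> S)"

definition FBL :: "(('a::real_normed_vector \<Rightarrow>\<^sub>L real) \<Rightarrow> real) set" where
  "FBL = closed_sublattice_H1 hull range delta"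

text \<open>
  Here \<open>X\<close> is the carrier of a Banach lattice with norm \<open>N\<close>, whose zero and order are
  inherited from the ambient type.
\<close>

definition strong_nakano :: "real \<Rightarrow> 'b::{zero,order} set \<Rightarrow> ('b \<Rightarrow> real) \<Rightarrow> bool" where
  "strong_nakano l X N \<longleftrightarrow>
     (\<forall>A. A \<subseteq> {a \<in> X. 0 \<le> a} \<and> A \<noteq> {} \<and> bdd_above (N ` A) \<and>
          (\<forall>a\<in>A. \<forall>b\<in>A. \<exists>c\<in>A. a \<le> c \<and> b \<le> c) \<longrightarrow>
        (\<exists>b\<in>X. (\<forall>a\<in>A. a \<le> b) \<and> N b \<le> l * (SUP a\<in>A. N a)))"

text \<open>
  The ambient space \<open>nat \<Rightarrow>\<^sub>C real\<close> is the space of bounded sequences with the supremum norm,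
  since the topology on \<^typ>\<open>nat\<close> is discrete.
\<close>

definition c0 :: "(nat \<Rightarrow>\<^sub>C real) set" where
  "c0 = {x. (\<lambda>n. apply_bcontfun x n) \<longlonglongrightarrow> 0}"

definition isomorphic_subspaces ::
    "'v::real_normed_vector set \<Rightarrow> 'w::real_normed_vector set \<Rightarrow> bool" where
  "isomorphic_subspaces V W \<longleftrightarrow>
     (\<exists>T T'. homeomorphism V W T T' \<and>
        (\<forall>x\<in>V. \<forall>y\<in>V. T (x + y) = T x + T y) \<and> (\<forall>c. \<forall>x\<in>V. T (c *\<^sub>R x) = c *\<^sub>R T x))"

end

theory Submission
  imports Defs
begin

text \<open>
  Let \<open>x n\<close> be the images in \<open>E\<close> of the unit vectors of \<open>c\<^sub>0\<close>. The increasing sequence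
  \<open>a N = max\<^bsub>n<N\<^esub> \<bar>\<delta>\<^bsub>x n\<^esub>\<bar>\<close> of positive elements of \<open>FBL[E]\<close> is bounded in norm and yet has no upper
  bound at all in \<open>FBL[E]\<close>. This contradicts the strong Nakano property for every constant.

  Boundedness holds because all signed sums \<open>\<Sum>n<N. \<plusminus> x n\<close> are bounded: for a single functional \<open>u\<close> the
  value \<open>a N u\<close> is at most the average of \<open>\<bar>u (\<Sum>n<N. \<plusminus> x n)\<bar>\<close> over all signs, and averages can be summed
  over any finite family of functionals (\<open>sum_sup_abs_deltas_le\<close>).

  For the absence of upper bounds, elements of \<open>FBL[E]\<close> are norm limits of lattice polynomials in
  finitely many evaluations. Hence every \<open>b\<close> in \<open>FBL[E]\<close> is controlled, up to \<open>\<epsilon> \<parallel>u\<parallel>\<close>, by the values of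
  \<open>u\<close> on a finite set of points (\<open>FBL_almost_finitely_dependent\<close>). The coordinate functionals of
  \<open>c\<^sub>0\<close> extend to a bounded sequence \<open>u n\<close> in the dual of \<open>E\<close> by the Hahn--Banach theorem. The \<open>u n\<close>
  themselves need not be weak* null, but they are bounded, so there are \<open>m \<noteq> n\<close> for which
  \<open>u n - u m\<close> is as small as desired on a given finite set. Since \<open>u n - u m\<close> takes the value \<open>1\<close> at \<open>x n\<close>,
  an upper bound \<open>b\<close> would be at least \<open>1\<close> there and less than \<open>1\<close> by finite dependence
  (\<open>biorthogonal_no_upper_bound\<close>).
\<close>

section \<open>Extension of bounded functionals\<close>

text \<open>
  The one-dimensional step of the Hahn--Banach theorem, phrased for graphs. A linear functional
  on a subspace, dominated by \<open>K * norm\<close>, is the same as a subspace \<open>M\<close> of the product with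
  \<open>r \<le> K * norm y\<close> on \<open>M\<close>. The value \<open>c\<close> at the new point \<open>x\<close> must lie above all
  \<open>r - K * norm (y - x)\<close> and below all \<open>K * norm (y + x) - r\<close>, and the triangle inequality leaves
  room between the two.
\<close>

lemma norm_dominated_extend_one:
  fixes M :: "('a::real_normed_vector \<times> real) set"
  assumes M: "subspace M" and dom: "\<And>y r. (y, r) \<in> M \<Longrightarrow> r \<le> K * norm y" and K: "0 \<le> K"
  shows "\<exists>c. \<forall>y r. (y, r) \<in> span (insert (x, c) M) \<longrightarrow> r \<le> K * norm y"
proof -
  have gap: "r - K * norm (y - x) \<le> K * norm (y' + x) - r'"
    if "(y, r) \<in> M" "(y', r') \<in> M" for y r y' r'
  proof -
    have "(y + y', r + r') \<in> M"
      using subspace_add[OF M that] by simp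
    then have "r + r' \<le> K * norm (y + y')" by (rule dom)
    also have "\<dots> \<le> K * (norm (y - x) + norm (y' + x))"
      using norm_triangle_ineq[of "y - x" "y' + x"] K by (intro mult_left_mono) auto
    finally show ?thesis by (simp add: algebra_simps)
  qed
  have zero: "(0, 0) \<in> M" using subspace_0[OF M] by (simp add: zero_prod_def)
  let ?L = "(\<lambda>(y, r). r - K * norm (y - x)) ` M"
  have bdd: "bdd_above ?L"
    using gap[OF _ zero] by (intro bdd_aboveI[where M = "K * norm x"]) auto
  define c where "c = Sup ?L"
  have lower: "r - K * norm (y - x) \<le> c" if "(y, r) \<in> M" for y r
    unfolding c_def by (rule cSup_upper[OF _ bdd]) (use that in force)
  have upper: "c \<le> K * norm (y + x) - r" if "(y, r) \<in> M" for y r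
    unfolding c_def using zero gap[OF _ that] by (intro cSup_least) auto
  have "r \<le> K * norm y" if "(y, r) \<in> span (insert (x, c) M)" for y r
  proof -
    obtain t where "(y, r) - t *\<^sub>R (x, c) \<in> M"
      using \<open>(y, r) \<in> _\<close> M by (auto simp: span_insert span_eq_iff[THEN iffD2])
    then have m: "(y - t *\<^sub>R x, r - t * c) \<in> M" by simp
    consider "t = 0" | "t > 0" | "t < 0" by linarith
    then show ?thesis
    proof cases
      case 1
      then show ?thesis using m dom by simp
    next
      case 2
      have "((1/t) *\<^sub>R (y - t *\<^sub>R x), (1/t) * (r - t * c)) \<in> M"
        using subspace_scale[OF M m, of "1/t"] by simp
      from upper[OF this] have "r / t \<le> K * norm ((1/t) *\<^sub>R y)"
        using 2 by (simp add: algebra_simps)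
      then show ?thesis using 2 by (simp add: field_simps)
    next
      case 3
      have "((-1/t) *\<^sub>R (y - t *\<^sub>R x), (-1/t) * (r - t * c)) \<in> M"
        using subspace_scale[OF M m, of "-1/t"] by simp
      from lower[OF this] have "- (r / t) \<le> K * norm ((-1/t) *\<^sub>R y)"
        using 3 by (simp add: algebra_simps)
      then show ?thesis using 3 by (simp add: field_simps)
    qed
  qed
  then show ?thesis by blast
qed

text \<open>
  Working with graphs makes the union of a chain of extensions again a subspace, so Zorn's
  lemma applies to sets of pairs directly. Functionality of the maximal graph comes for free
  from the domination by the norm.
\<close>

theorem Hahn_Banach_norm_preserving:
  fixes F :: "'a::real_normed_vector set" and \<phi> :: "'a \<Rightarrow> real"
  assumes F: "subspace F"
    and add: "\<And>x y. x \<in> F \<Longrightarrow> y \<in> F \<Longrightarrow> \<phi> (x + y) = \<phi> x + \<phi> y"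
    and scale: "\<And>c x. x \<in> F \<Longrightarrow> \<phi> (c *\<^sub>R x) = c * \<phi> x"
    and bound: "\<And>x. x \<in> F \<Longrightarrow> \<bar>\<phi> x\<bar> \<le> K * norm x" and K: "0 \<le> K"
  shows "\<exists>u :: 'a \<Rightarrow>\<^sub>L real. (\<forall>x\<in>F. blinfun_apply u x = \<phi> x) \<and> norm u \<le> K"
proof -
  define G where "G = (\<lambda>x. (x, \<phi> x)) ` F"
  define \<A> where "\<A> = {M. subspace M \<and> G \<subseteq> M \<and> (\<forall>y r. (y, r) \<in> M \<longrightarrow> r \<le> K * norm y)}"
  have "subspace G"
    unfolding subspace_def
  proof (intro conjI ballI allI)
    have "\<phi> 0 = 0" using scale[of 0 0] subspace_0[OF F] by simp
    then show "0 \<in> G" using subspace_0[OF F] by (force simp: G_def zero_prod_def)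
  qed (auto simp: G_def add scale image_iff intro: subspace_add[OF F] subspace_scale[OF F])
  moreover have "r \<le> K * norm y" if "(y, r) \<in> G" for y r
    using that bound[of y] by (auto simp: G_def)
  ultimately have G: "G \<in> \<A>" by (auto simp: \<A>_def)
  have "\<exists>M\<in>\<A>. \<forall>X\<in>\<A>. M \<subseteq> X \<longrightarrow> X = M"
  proof (rule subset_Zorn_nonempty)
    show "\<A> \<noteq> {}" using G by auto
  next
    fix \<C> assume ne: "\<C> \<noteq> {}" and ch: "subset.chain \<A> \<C>"
    have sub: "\<C> \<subseteq> \<A>" and lin: "\<And>X Y. X \<in> \<C> \<Longrightarrow> Y \<in> \<C> \<Longrightarrow> X \<subseteq> Y \<or> Y \<subseteq> X"
      using ch by (auto simp: subset_chain_def)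
    have "subspace (\<Union>\<C>)"
      unfolding subspace_def
    proof (intro conjI ballI allI)
      obtain X where "X \<in> \<C>" using ne by auto
      then show "0 \<in> \<Union>\<C>" using sub subspace_0[of X] by (auto simp: \<A>_def)
    next
      fix p q assume "p \<in> \<Union>\<C>" "q \<in> \<Union>\<C>"
      then obtain X Y where "X \<in> \<C>" "p \<in> X" "Y \<in> \<C>" "q \<in> Y" by auto
      then obtain Z where "Z \<in> \<C>" "p \<in> Z" "q \<in> Z" using lin by blast
      then show "p + q \<in> \<Union>\<C>" using sub by (auto simp: \<A>_def intro: subspace_add)
    next
      fix c p assume "p \<in> \<Union>\<C>"
      then show "c *\<^sub>R p \<in> \<Union>\<C>" using sub by (auto simp: \<A>_def intro: subspace_scale)
    qed
    then show "\<Union>\<C> \<in> \<A>" using ne sub unfolding \<A>_def by blast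
  qed
  then obtain M where "M \<in> \<A>" and max: "\<And>X. X \<in> \<A> \<Longrightarrow> M \<subseteq> X \<Longrightarrow> X = M" by blast
  then have M: "subspace M" "G \<subseteq> M" and dom: "\<And>y r. (y, r) \<in> M \<Longrightarrow> r \<le> K * norm y"
    by (auto simp: \<A>_def)
  have total: "\<exists>r. (x, r) \<in> M" for x
  proof -
    obtain c where c: "\<forall>y r. (y, r) \<in> span (insert (x, c) M) \<longrightarrow> r \<le> K * norm y"
      using norm_dominated_extend_one[OF M(1) dom K] by blast
    have "insert (x, c) M \<subseteq> span (insert (x, c) M)" by (rule span_superset)
    moreover from this c M(2) have "span (insert (x, c) M) \<in> \<A>"
      by (auto simp: \<A>_def)
    ultimately show ?thesis using max by blast
  qed
  \<comment> \<open>The difference of two values at \<open>y\<close> is a value at \<open>0\<close>, so it is at most \<open>0\<close>.\<close>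
  have le: "r \<le> r'" if "(y, r) \<in> M" "(y, r') \<in> M" for y r r'
    using dom[of 0 "r - r'"] subspace_diff[OF M(1) that] by simp
  define h where "h x = (SOME r. (x, r) \<in> M)" for x
  have h: "(x, h x) \<in> M" for x unfolding h_def using total by (rule someI_ex)
  have h_eq: "h y = r" if "(y, r) \<in> M" for y r
    using le[OF h that] le[OF that h] by simp
  have hb: "norm (h x) \<le> norm x * K" for x
    using dom[OF h, of x] dom[OF subspace_neg[OF M(1) h[of x], simplified]]
    by (simp add: abs_le_iff mult.commute)
  have "bounded_linear h"
  proof (rule bounded_linear_intro[OF _ _ hb])
    show "h (x + y) = h x + h y" for x y
      using subspace_add[OF M(1) h[of x] h[of y]] by (intro h_eq) simp
    show "h (c *\<^sub>R x) = c *\<^sub>R h x" for c x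
      using subspace_scale[OF M(1) h[of x], of c] by (intro h_eq) simp
  qed
  then have ap: "blinfun_apply (Blinfun h) = h" by (rule bounded_linear_Blinfun_apply)
  have "norm (Blinfun h) \<le> K"
    using hb by (intro norm_blinfun_bound[OF K]) (simp add: ap mult.commute)
  moreover have "h x = \<phi> x" if "x \<in> F" for x
    using M(2) that by (intro h_eq) (auto simp: G_def)
  ultimately show ?thesis using ap by (intro exI[of _ "Blinfun h"]) simp
qed

text \<open>
  An isomorphism of subspaces is a homeomorphism that is linear only on its domain, so the
  equivalence of continuity and boundedness is needed relative to a subspace.
\<close>

lemma linear_continuous_on_subspace_bounded:
  fixes T :: "'v::real_normed_vector \<Rightarrow> 'w::real_normed_vector"
  assumes V: "subspace V" and cont: "continuous_on V T"
    and scale: "\<And>c x. x \<in> V \<Longrightarrow> T (c *\<^sub>R x) = c *\<^sub>R T x"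
  shows "\<exists>K>0. \<forall>x\<in>V. norm (T x) \<le> K * norm x"
proof -
  have 0: "0 \<in> V" "T 0 = 0" using subspace_0[OF V] scale[of 0 0] by auto
  obtain d where d: "d > 0" "\<And>x. x \<in> V \<Longrightarrow> norm x < d \<Longrightarrow> norm (T x) < 1"
    using cont 0 unfolding continuous_on_iff by (metis dist_0_norm dist_commute zero_less_one)
  have "norm (T x) \<le> (2 / d) * norm x" if x: "x \<in> V" for x
  proof (cases "x = 0")
    case False
    define c where "c = d / (2 * norm x)"
    have c: "c > 0" using False d(1) by (simp add: c_def)
    have "norm (c *\<^sub>R x) < d" using False d(1) by (simp add: c_def)
    then have "norm (c *\<^sub>R T x) < 1"
      using d(2)[OF subspace_scale[OF V x]] scale[OF x] by simp
    then have "norm (T x) < 1 / c" using c by (simp add: field_simps)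
    then show ?thesis by (simp add: c_def)
  qed (simp add: 0)
  then show ?thesis using d(1) by (intro exI[of _ "2 / d"]) auto
qed

section \<open>The lattice norm\<close>

text \<open>
  A real \<open>Sup\<close> says something only about sets that are bounded above. Here the sum of the norms of
  the functionals is a bound, so the constraint on an admissible family really controls its
  value at every point.
\<close>

lemma sum_abs_le_norm:
  fixes us :: "nat \<Rightarrow> ('a::real_normed_vector \<Rightarrow>\<^sub>L real)"
  assumes "(SUP x\<in>cball 0 1. \<Sum>i=1..m. \<bar>blinfun_apply (us i) x\<bar>) \<le> 1"
  shows "(\<Sum>i=1..m. \<bar>blinfun_apply (us i) x\<bar>) \<le> norm x"
proof (cases "x = 0")
  case False
  let ?s = "\<lambda>x. \<Sum>i=1..m. \<bar>blinfun_apply (us i) x\<bar>"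
  have "?s x \<le> (\<Sum>i=1..m. norm (us i))" if "x \<in> cball 0 1" for x
  proof (rule sum_mono)
    fix i
    have "\<bar>us i x\<bar> \<le> norm (us i) * norm x" using norm_blinfun[of "us i" x] by simp
    also have "\<dots> \<le> norm (us i)" using that by (simp add: mult_left_le)
    finally show "\<bar>us i x\<bar> \<le> norm (us i)" .
  qed
  then have "bdd_above (?s ` cball 0 1)" by (rule bdd_aboveI2)
  then have "?s ((1 / norm x) *\<^sub>R x) \<le> (SUP x\<in>cball 0 1. ?s x)"
    using False by (intro cSUP_upper) auto
  then have "?s ((1 / norm x) *\<^sub>R x) \<le> 1" using assms by linarith
  moreover have "?s ((1 / norm x) *\<^sub>R x) = ?s x / norm x"
    by (simp add: blinfun.scaleR_right abs_mult sum_divide_distrib)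
  ultimately have "?s x / norm x \<le> 1" by simp
  then show ?thesis using False by (simp add: pos_divide_le_eq del: sum_divide_distrib)
qed (simp add: blinfun.zero_right)

lemma fbl_sums_bounded_by:
  assumes "\<And>m us. (SUP x\<in>cball 0 1. \<Sum>i=1..m. \<bar>blinfun_apply (us i) x\<bar>) \<le> 1
      \<Longrightarrow> (\<Sum>i=1..(m::nat). \<bar>f (us i)\<bar>) \<le> C"
  shows "s \<in> fbl_sums f \<Longrightarrow> s \<le> C"
  using assms by (auto simp: fbl_sums_def)

lemma fbl_norm_le:
  assumes "\<And>m us. (SUP x\<in>cball 0 1. \<Sum>i=1..m. \<bar>blinfun_apply (us i) x\<bar>) \<le> 1
      \<Longrightarrow> (\<Sum>i=1..(m::nat). \<bar>f (us i)\<bar>) \<le> C"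
  shows "fbl_norm f \<le> C"
  unfolding fbl_norm_def
proof (rule cSup_least)
  have "(\<Sum>i=1..0::nat. \<bar>f (undefined i)\<bar>) \<in> fbl_sums f"
    unfolding fbl_sums_def by (rule CollectI, rule exI[of _ "0::nat"], rule exI[of _ undefined]) simp
  then show "fbl_sums f \<noteq> {}" by blast
qed (rule fbl_sums_bounded_by[OF assms])

lemma abs_le_fbl_norm:
  assumes "f \<in> H1"
  shows "\<bar>f u\<bar> \<le> fbl_norm f * norm u"
proof (cases "u = 0")
  case True
  have "f (0 *\<^sub>R u) = 0 * f u" using assms unfolding H1_def pos_homogeneous_def by blast
  then show ?thesis using True by simp
next
  case False
  define v where "v = (1 / norm u) *\<^sub>R u"
  have "\<bar>blinfun_apply v x\<bar> \<le> 1" if "norm x \<le> 1" for x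
  proof -
    have "\<bar>blinfun_apply v x\<bar> \<le> norm v * norm x" using norm_blinfun[of v x] by simp
    then show ?thesis using that False by (simp add: v_def)
  qed
  then have "(SUP x\<in>cball 0 1. \<Sum>i=1..1::nat. \<bar>blinfun_apply v x\<bar>) \<le> 1"
    by (intro cSUP_least) auto
  then have "(\<Sum>i=1..1::nat. \<bar>f v\<bar>) \<in> fbl_sums f"
    unfolding fbl_sums_def
    by (intro CollectI exI[of _ "1::nat"] exI[of _ "\<lambda>_. v"]) simp
  then have "\<bar>f v\<bar> \<le> fbl_norm f"
    using assms unfolding fbl_norm_def H1_def by (intro cSup_upper) auto
  moreover have "f u = norm u * f v"
  proof -
    have "f (norm u *\<^sub>R v) = norm u * f v"
      using assms by (simp add: H1_def pos_homogeneous_def)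
    then show ?thesis using False by (simp add: v_def)
  qed
  ultimately show ?thesis using False by (simp add: abs_mult mult.commute mult_left_mono)
qed

text \<open>
  All closure properties of \<^term>\<open>H1\<close> that occur below are instances of this: the lattice and
  vector operations are dominated by linear combinations of absolute values.
\<close>

lemma H1_memI:
  fixes f g h :: "('a::real_normed_vector \<Rightarrow>\<^sub>L real) \<Rightarrow> real"
  assumes "pos_homogeneous h" "f \<in> H1" "g \<in> H1"
    and le: "\<And>u. \<bar>h u\<bar> \<le> a * \<bar>f u\<bar> + b * \<bar>g u\<bar>" and "0 \<le> a" "0 \<le> b"
  shows "h \<in> H1"
proof -
  obtain A B where A: "\<And>s. s \<in> fbl_sums f \<Longrightarrow> s \<le> A" and B: "\<And>s. s \<in> fbl_sums g \<Longrightarrow> s \<le> B"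
    using assms(2,3) by (auto simp: H1_def bdd_above_def)
  have "s \<le> a * A + b * B" if "s \<in> fbl_sums h" for s
  proof (rule fbl_sums_bounded_by[OF _ that])
    fix m and us :: "nat \<Rightarrow> 'a \<Rightarrow>\<^sub>L real"
    assume us: "(SUP x\<in>cball 0 1. \<Sum>i=1..m. \<bar>blinfun_apply (us i) x\<bar>) \<le> 1"
    have "(\<Sum>i=1..m. \<bar>h (us i)\<bar>) \<le> (\<Sum>i=1..m. a * \<bar>f (us i)\<bar> + b * \<bar>g (us i)\<bar>)"
      by (intro sum_mono le)
    also have "\<dots> = a * (\<Sum>i=1..m. \<bar>f (us i)\<bar>) + b * (\<Sum>i=1..m. \<bar>g (us i)\<bar>)"
      by (simp add: sum.distrib sum_distrib_left)
    also have "\<dots> \<le> a * A + b * B"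
      using us assms(5,6) by (intro add_mono mult_left_mono A B) (auto simp: fbl_sums_def)
    finally show "(\<Sum>i=1..m. \<bar>h (us i)\<bar>) \<le> a * A + b * B" .
  qed
  then have "bdd_above (fbl_sums h)" by (rule bdd_aboveI)
  then show ?thesis using assms(1) by (simp add: H1_def)
qed

lemma H1_homogeneous: "f \<in> H1 \<Longrightarrow> 0 \<le> c \<Longrightarrow> f (c *\<^sub>R u) = c * f u"
  by (simp add: H1_def pos_homogeneous_def)

lemma delta_in_H1: "delta x \<in> H1"
proof -
  have "s \<le> norm x" if "s \<in> fbl_sums (delta x)" for s
    by (rule fbl_sums_bounded_by[OF _ that]) (simp only: delta_def sum_abs_le_norm)
  then have "bdd_above (fbl_sums (delta x))" by (rule bdd_aboveI)
  then show ?thesis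
    by (simp add: H1_def pos_homogeneous_def delta_def blinfun.scaleR_left)
qed

section \<open>Almost finite dependence\<close>

text \<open>
  A quantitative form of weak* continuity at \<open>0\<close> on bounded sets. Stated as a domination
  rather than with an approximating function, it passes to sums, suprema, infima and norm
  limits by the triangle inequality alone.
\<close>

definition almost_finitely_dependent ::
    "(('a::real_normed_vector \<Rightarrow>\<^sub>L real) \<Rightarrow> real) \<Rightarrow> bool" where
  "almost_finitely_dependent f \<longleftrightarrow>
     (\<forall>e>0. \<exists>Y C. finite Y \<and> (\<forall>u. \<bar>f u\<bar> \<le> C * (\<Sum>y\<in>Y. \<bar>blinfun_apply u y\<bar>) + e * norm u))"

lemma almost_finitely_dependent_delta: "almost_finitely_dependent (delta x)"
  unfolding almost_finitely_dependent_def delta_def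
  by (intro allI impI exI[of _ "{x}"] exI[of _ 1]) simp

lemma almost_finitely_dependentD:
  assumes "almost_finitely_dependent f" "e > 0"
  obtains Y C where "finite Y" "C \<ge> 0"
    "\<And>u. \<bar>f u\<bar> \<le> C * (\<Sum>y\<in>Y. \<bar>blinfun_apply u y\<bar>) + e * norm u"
proof -
  obtain Y C where Y: "finite Y" "\<And>u. \<bar>f u\<bar> \<le> C * (\<Sum>y\<in>Y. \<bar>blinfun_apply u y\<bar>) + e * norm u"
    using assms unfolding almost_finitely_dependent_def by blast
  have "\<bar>f u\<bar> \<le> \<bar>C\<bar> * (\<Sum>y\<in>Y. \<bar>blinfun_apply u y\<bar>) + e * norm u" for u
  proof -
    have "C * (\<Sum>y\<in>Y. \<bar>blinfun_apply u y\<bar>) \<le> \<bar>C\<bar> * (\<Sum>y\<in>Y. \<bar>blinfun_apply u y\<bar>)"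
      by (intro mult_right_mono sum_nonneg) auto
    with Y(2)[of u] show ?thesis by linarith
  qed
  with Y(1) show thesis using that[of Y "\<bar>C\<bar>"] by auto
qed

lemma almost_finitely_dependent_dominated:
  assumes f: "almost_finitely_dependent f" and g: "almost_finitely_dependent g"
    and le: "\<And>u. \<bar>h u\<bar> \<le> a * (\<bar>f u\<bar> + \<bar>g u\<bar>)" and a: "0 < a"
  shows "almost_finitely_dependent h"
  unfolding almost_finitely_dependent_def
proof (intro allI impI)
  fix e :: real assume "e > 0"
  then have e: "e / (2 * a) > 0" using a by simp
  obtain Y C where Y: "finite Y" "C \<ge> 0"
      "\<And>u. \<bar>f u\<bar> \<le> C * (\<Sum>y\<in>Y. \<bar>blinfun_apply u y\<bar>) + e / (2 * a) * norm u"
    by (rule almost_finitely_dependentD[OF f e]) (rule that)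
  obtain Z D where Z: "finite Z" "D \<ge> 0"
      "\<And>u. \<bar>g u\<bar> \<le> D * (\<Sum>y\<in>Z. \<bar>blinfun_apply u y\<bar>) + e / (2 * a) * norm u"
    by (rule almost_finitely_dependentD[OF g e]) (rule that)
  have "\<bar>h u\<bar> \<le> (a * (C + D)) * (\<Sum>y\<in>Y \<union> Z. \<bar>blinfun_apply u y\<bar>) + e * norm u" for u
  proof -
    let ?S = "\<lambda>Y. \<Sum>y\<in>Y. \<bar>blinfun_apply u y\<bar>"
    have "?S Y \<le> ?S (Y \<union> Z)" "?S Z \<le> ?S (Y \<union> Z)"
      using Y(1) Z(1) by (auto intro!: sum_mono2)
    then have "C * ?S Y \<le> C * ?S (Y \<union> Z)" "D * ?S Z \<le> D * ?S (Y \<union> Z)"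
      using Y(2) Z(2) by (auto intro!: mult_left_mono)
    moreover define k where "k = e / (2 * a) * norm u"
    ultimately have "\<bar>f u\<bar> + \<bar>g u\<bar> \<le> C * ?S (Y \<union> Z) + D * ?S (Y \<union> Z) + 2 * k"
      using Y(3)[of u] Z(3)[of u] by linarith
    then have "a * (\<bar>f u\<bar> + \<bar>g u\<bar>) \<le> a * (C * ?S (Y \<union> Z) + D * ?S (Y \<union> Z) + 2 * k)"
      using a by simp
    also have "\<dots> = (a * (C + D)) * ?S (Y \<union> Z) + a * (2 * k)"
      by (simp only: algebra_simps)
    also have "a * (2 * k) = e * norm u" using a by (simp add: k_def)
    finally show ?thesis using le[of u] by linarith
  qed
  then show "\<exists>Y C. finite Y \<and> (\<forall>u. \<bar>h u\<bar> \<le> C * (\<Sum>y\<in>Y. \<bar>blinfun_apply u y\<bar>) + e * norm u)"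
    using Y(1) Z(1) by (intro exI[of _ "Y \<union> Z"] exI[of _ "a * (C + D)"]) auto
qed

text \<open>
  A norm-close \<open>g n\<close> differs from \<open>f\<close> at \<open>u\<close> by at most a small multiple of \<open>norm u\<close>, which the error
  term absorbs.
\<close>

lemma almost_finitely_dependent_limit:
  assumes g: "\<And>n. g n \<in> H1" "\<And>n. almost_finitely_dependent (g n)" and f: "f \<in> H1"
    and lim: "(\<lambda>n. fbl_norm (g n - f)) \<longlonglongrightarrow> 0"
  shows "almost_finitely_dependent f"
  unfolding almost_finitely_dependent_def
proof (intro allI impI)
  fix e :: real assume "e > 0"
  then have e: "e / 2 > 0" by simp
  obtain n where n: "fbl_norm (g n - f) < e / 2"
    using order_tendstoD(2)[OF lim e] by (auto simp: eventually_sequentially)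
  obtain Y C where Y: "finite Y" "C \<ge> 0"
      "\<And>u. \<bar>g n u\<bar> \<le> C * (\<Sum>y\<in>Y. \<bar>blinfun_apply u y\<bar>) + e / 2 * norm u"
    by (rule almost_finitely_dependentD[OF g(2)[of n] e]) (rule that)
  have "g n - f \<in> H1"
  proof (rule H1_memI[OF _ g(1)[of n] f])
    show "pos_homogeneous (g n - f)"
      using H1_homogeneous[OF g(1)[of n]] H1_homogeneous[OF f]
      by (simp add: pos_homogeneous_def right_diff_distrib)
    show "\<bar>(g n - f) u\<bar> \<le> 1 * \<bar>g n u\<bar> + 1 * \<bar>f u\<bar>" for u by simp
  qed simp_all
  have near: "\<bar>g n u - f u\<bar> \<le> e / 2 * norm u" for u
  proof -
    have "\<bar>g n u - f u\<bar> \<le> fbl_norm (g n - f) * norm u"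
      using abs_le_fbl_norm[OF \<open>g n - f \<in> H1\<close>, of u] by simp
    also have "\<dots> \<le> e / 2 * norm u" using n by (intro mult_right_mono) auto
    finally show ?thesis .
  qed
  have "\<bar>f u\<bar> \<le> C * (\<Sum>y\<in>Y. \<bar>blinfun_apply u y\<bar>) + e * norm u" for u
  proof -
    have "\<bar>f u\<bar> \<le> \<bar>g n u\<bar> + \<bar>g n u - f u\<bar>" by linarith
    also have "\<dots> \<le> C * (\<Sum>y\<in>Y. \<bar>blinfun_apply u y\<bar>) + e / 2 * norm u + e / 2 * norm u"
      by (intro add_mono Y(3) near)
    finally show ?thesis by simp
  qed
  then show "\<exists>Y C. finite Y \<and> (\<forall>u. \<bar>f u\<bar> \<le> C * (\<Sum>y\<in>Y. \<bar>blinfun_apply u y\<bar>) + e * norm u)"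
    using Y(1) by blast
qed

text \<open>
  This is what transfers the property from the evaluations to the whole free Banach lattice,
  which is the least closed sublattice containing them.
\<close>

lemma closed_sublattice_almost_finitely_dependent:
  "closed_sublattice_H1 {f \<in> H1. almost_finitely_dependent f}" (is "closed_sublattice_H1 ?S")
  unfolding closed_sublattice_H1_def
proof (intro conjI ballI allI impI)
  have dom: "h \<in> ?S" if "f \<in> ?S" "g \<in> ?S" "pos_homogeneous h"
    "\<And>u. \<bar>h u\<bar> \<le> a * (\<bar>f u\<bar> + \<bar>g u\<bar>)" "0 < a" for f g h a
    using H1_memI[of h f g a a] almost_finitely_dependent_dominated[of f g h a] that
    by (auto simp: algebra_simps)
  have hom: "f (c *\<^sub>R u) = c * f u" if "f \<in> ?S" "0 \<le> c" for f c u
    using that H1_homogeneous by blast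
  have d0: "delta 0 \<in> ?S" by (simp add: delta_in_H1 almost_finitely_dependent_delta)
  then show "0 \<in> ?S" by (simp add: delta_def zero_fun_def blinfun.zero_right)
  fix f assume f: "f \<in> ?S"
  show "(\<lambda>u. c * f u) \<in> ?S" for c
  proof (rule dom[OF f f])
    show "pos_homogeneous (\<lambda>u. c * f u)" by (simp add: pos_homogeneous_def hom[OF f])
    show "\<bar>c * f u\<bar> \<le> (\<bar>c\<bar> + 1) * (\<bar>f u\<bar> + \<bar>f u\<bar>)" for u
      by (simp add: abs_mult distrib_left distrib_right)
  qed simp
  fix g assume g: "g \<in> ?S"
  show "f + g \<in> ?S"
  proof (rule dom[OF f g])
    show "pos_homogeneous (f + g)" by (simp add: pos_homogeneous_def hom[OF f] hom[OF g] distrib_left)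
    show "\<bar>(f + g) u\<bar> \<le> 1 * (\<bar>f u\<bar> + \<bar>g u\<bar>)" for u by simp
  qed simp
  show "sup f g \<in> ?S"
  proof (rule dom[OF f g])
    show "pos_homogeneous (sup f g)"
      by (simp add: pos_homogeneous_def hom[OF f] hom[OF g] sup_max max_mult_distrib_left)
    show "\<bar>(sup f g) u\<bar> \<le> 1 * (\<bar>f u\<bar> + \<bar>g u\<bar>)" for u by (simp add: sup_max)
  qed simp
  show "inf f g \<in> ?S"
  proof (rule dom[OF f g])
    show "pos_homogeneous (inf f g)"
      by (simp add: pos_homogeneous_def hom[OF f] hom[OF g] inf_min min_mult_distrib_left)
    show "\<bar>(inf f g) u\<bar> \<le> 1 * (\<bar>f u\<bar> + \<bar>g u\<bar>)" for u by (simp add: inf_min)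
  qed simp
next
  show "f \<in> ?S" if "(\<forall>n. g n \<in> ?S) \<and> f \<in> H1 \<and> (\<lambda>n. fbl_norm (g n - f)) \<longlonglongrightarrow> 0" for g :: "nat \<Rightarrow> _" and f
    using that almost_finitely_dependent_limit[of g f] by auto
  show "?S \<subseteq> H1" by blast
qed

lemma FBL_almost_finitely_dependent:
  assumes "f \<in> FBL"
  shows "almost_finitely_dependent f"
proof -
  have "FBL \<subseteq> {f \<in> H1. almost_finitely_dependent f}"
    unfolding FBL_def
    by (intro hull_minimal closed_sublattice_almost_finitely_dependent)
      (auto simp: delta_in_H1 almost_finitely_dependent_delta)
  then show ?thesis using assms by auto
qed

lemma FBL_lattice_closed:
  shows delta_in_FBL: "delta x \<in> FBL" and zero_in_FBL: "0 \<in> FBL"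
    and sup_in_FBL: "f \<in> FBL \<Longrightarrow> g \<in> FBL \<Longrightarrow> sup f g \<in> FBL"
  unfolding FBL_def hull_def closed_sublattice_H1_def by blast+

section \<open>Finite suprema of evaluations\<close>

text \<open>
  The modulus of an evaluation is written as the supremum of \<open>\<delta>\<^bsub>x\<^esub>\<close> and \<open>\<delta>\<^bsub>-x\<^esub>\<close>, which shows membership
  in \<^term>\<open>FBL\<close> at once.
\<close>

primrec sup_abs_deltas :: "(nat \<Rightarrow> 'a::real_normed_vector) \<Rightarrow> nat \<Rightarrow> ('a \<Rightarrow>\<^sub>L real) \<Rightarrow> real" where
  "sup_abs_deltas x 0 = 0"
| "sup_abs_deltas x (Suc n) = sup (sup_abs_deltas x n) (sup (delta (x n)) (delta (- x n)))"

lemma sup_abs_deltas_in_FBL: "sup_abs_deltas x n \<in> FBL"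
proof (induction n)
  case 0
  then show ?case using zero_in_FBL by (simp add: zero_fun_def)
next
  case (Suc n)
  from sup_in_FBL[OF this sup_in_FBL[OF delta_in_FBL delta_in_FBL]] show ?case
    by (simp add: sup_fun_def)
qed

lemma sup_abs_deltas_Suc_apply:
  "sup_abs_deltas x (Suc n) u = max (sup_abs_deltas x n u) \<bar>blinfun_apply u (x n)\<bar>"
  by (auto simp: delta_def sup_max blinfun.minus_right abs_real_def)

lemma sup_abs_deltas_nonneg: "0 \<le> sup_abs_deltas x n u"
proof (induction n)
  case (Suc n)
  then show ?case unfolding sup_abs_deltas_Suc_apply by simp
qed simp

lemma sup_abs_deltas_mono: "m \<le> n \<Longrightarrow> sup_abs_deltas x m \<le> sup_abs_deltas x n"
  by (rule lift_Suc_mono_le) (auto simp: le_fun_def)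

text \<open>
  Averaging over signs, arranged as an induction. For real numbers the average of \<open>\<bar>p + q\<bar>\<close>
  and \<open>\<bar>p - q\<bar>\<close> is \<open>max \<bar>p\<bar> \<bar>q\<bar>\<close>. The last vector \<open>x N\<close> is therefore absorbed into the base point \<open>z\<close> with
  either sign, and the two resulting estimates are averaged. The base point is there only to carry
  this induction; it becomes \<open>0\<close> in the application.
\<close>

lemma sum_sup_abs_deltas_le:
  fixes x :: "nat \<Rightarrow> 'a::real_normed_vector"
  assumes "\<And>s. (\<forall>n. \<bar>s n\<bar> = 1) \<Longrightarrow>
      (\<Sum>i\<in>I. \<bar>blinfun_apply (u i) (z + (\<Sum>n<N. s n *\<^sub>R x n))\<bar>) \<le> C"
  shows "(\<Sum>i\<in>I. max \<bar>blinfun_apply (u i) z\<bar> (sup_abs_deltas x N (u i))) \<le> C"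
  using assms
proof (induction N arbitrary: z)
  case 0
  from 0[of "\<lambda>_. 1"] show ?case by (simp add: max_absorb1)
next
  case (Suc N)
  let ?m = "\<lambda>w i. max \<bar>blinfun_apply (u i) w\<bar> (sup_abs_deltas x N (u i))"
  have half: "(\<Sum>i\<in>I. ?m (z + c *\<^sub>R x N) i) \<le> C" if c: "\<bar>c\<bar> = 1" for c
  proof (rule Suc.IH)
    fix s :: "nat \<Rightarrow> real" assume s: "\<forall>n. \<bar>s n\<bar> = 1"
    have "(\<Sum>n<Suc N. (s(N := c)) n *\<^sub>R x n) = (\<Sum>n<N. s n *\<^sub>R x n) + c *\<^sub>R x N"
      by (simp add: sum.lessThan_Suc)
    then show "(\<Sum>i\<in>I. \<bar>blinfun_apply (u i) (z + c *\<^sub>R x N + (\<Sum>n<N. s n *\<^sub>R x n))\<bar>) \<le> C"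
      using Suc.prems[of "s(N := c)"] s c by (simp add: algebra_simps)
  qed
  have "(\<Sum>i\<in>I. max \<bar>blinfun_apply (u i) z\<bar> (sup_abs_deltas x (Suc N) (u i)))
      \<le> (\<Sum>i\<in>I. (?m (z + 1 *\<^sub>R x N) i + ?m (z + (-1) *\<^sub>R x N) i) / 2)"
  proof (rule sum_mono)
    fix i
    show "max \<bar>blinfun_apply (u i) z\<bar> (sup_abs_deltas x (Suc N) (u i))
        \<le> (?m (z + 1 *\<^sub>R x N) i + ?m (z + (-1) *\<^sub>R x N) i) / 2"
      unfolding sup_abs_deltas_Suc_apply blinfun.add_right blinfun.scaleR_right by simp
  qed
  also have "\<dots> = ((\<Sum>i\<in>I. ?m (z + 1 *\<^sub>R x N) i) + (\<Sum>i\<in>I. ?m (z + (-1) *\<^sub>R x N) i)) / 2"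
    by (simp only: sum_divide_distrib[symmetric] sum.distrib)
  also have "\<dots> \<le> C" using half[of 1] half[of "-1"] by simp
  finally show ?case .
qed

lemma fbl_norm_sup_abs_deltas_le:
  fixes x :: "nat \<Rightarrow> 'a::real_normed_vector"
  assumes "\<And>s. (\<forall>n. \<bar>s n\<bar> = 1) \<Longrightarrow> norm (\<Sum>n<N. s n *\<^sub>R x n) \<le> K"
  shows "fbl_norm (sup_abs_deltas x N) \<le> K"
proof (rule fbl_norm_le)
  fix m and us :: "nat \<Rightarrow> 'a \<Rightarrow>\<^sub>L real"
  assume us: "(SUP x\<in>cball 0 1. \<Sum>i=1..m. \<bar>blinfun_apply (us i) x\<bar>) \<le> 1"
  have "(\<Sum>i=1..m. max \<bar>blinfun_apply (us i) 0\<bar> (sup_abs_deltas x N (us i))) \<le> K"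
    using sum_abs_le_norm[OF us] assms by (intro sum_sup_abs_deltas_le) (auto intro: order_trans)
  then show "(\<Sum>i=1..m. \<bar>sup_abs_deltas x N (us i)\<bar>) \<le> K"
    by (simp add: blinfun.zero_right sup_abs_deltas_nonneg max_absorb2)
qed

section \<open>Biorthogonal sequences and upper bounds\<close>

text \<open>
  The Bolzano--Weierstrass theorem in finitely many coordinates. It stands in for weak*
  compactness: only finitely many points matter at a time.
\<close>

lemma common_convergent_subsequence:
  fixes u :: "nat \<Rightarrow> 'b \<Rightarrow> real"
  assumes "finite Y" "\<And>y. y \<in> Y \<Longrightarrow> bounded (range (\<lambda>n. u n y))"
  shows "\<exists>r :: nat \<Rightarrow> nat. strict_mono r \<and> (\<forall>y\<in>Y. convergent (\<lambda>n. u (r n) y))"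
  using assms
proof (induction Y rule: finite_induct)
  case empty
  show ?case by (intro exI[of _ id]) (simp add: strict_mono_def)
next
  case (insert y Y)
  then obtain r :: "nat \<Rightarrow> nat" where r: "strict_mono r" "\<And>y. y \<in> Y \<Longrightarrow> convergent (\<lambda>n. u (r n) y)"
    by auto
  have "bounded (range (\<lambda>n. u (r n) y))"
    by (rule bounded_subset[OF insert.prems[of y]]) auto
  then obtain l t where t: "strict_mono t" "((\<lambda>n. u (r n) y) \<circ> t) \<longlonglongrightarrow> l"
    using bounded_imp_convergent_subsequence by blast
  have "convergent (\<lambda>n. u ((r \<circ> t) n) y')" if "y' \<in> insert y Y" for y'
  proof (cases "y' = y")
    case True
    then show ?thesis using t(2) by (auto simp: convergent_def o_def)
  next
    case False
    then have "convergent (\<lambda>n. u (r n) y')" using that r(2) by auto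
    from convergent_subseq_convergent[OF this t(1)] show ?thesis by (simp add: o_def)
  qed
  then show ?case using strict_mono_o[OF r(1) t(1)] by blast
qed

text \<open>
  The test functionals are differences \<open>u m - u n\<close>: a subsequence of \<open>u\<close> that converges on the relevant
  finite set has consecutive differences tending to \<open>0\<close> there, while biorthogonality keeps the
  value \<open>1\<close> at one of the points \<open>x m\<close>.
\<close>

lemma biorthogonal_no_upper_bound:
  fixes x :: "nat \<Rightarrow> 'a::real_normed_vector" and u :: "nat \<Rightarrow> 'a \<Rightarrow>\<^sub>L real"
  assumes bi: "\<And>m n. blinfun_apply (u n) (x m) = (if m = n then 1 else 0)"
    and K: "\<And>n. norm (u n) \<le> K"
    and b: "b \<in> FBL"
  shows "\<exists>n v. b v < \<bar>blinfun_apply v (x n)\<bar>"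
proof (rule ccontr)
  assume "\<not> ?thesis"
  then have above: "\<bar>blinfun_apply v (x n)\<bar> \<le> b v" for v n by (simp add: not_less)
  have K0: "0 \<le> K" using K[of 0] norm_ge_zero order_trans by blast
  \<comment> \<open>The test functional has norm at most \<open>2 * K\<close>, so the error term stays below \<open>1/2\<close>.\<close>
  define e where "e = 1 / (4 * (K + 1))"
  have e: "e > 0" using K0 by (simp add: e_def)
  obtain Y C where Y: "finite Y" "C \<ge> 0"
    and dep: "\<And>v. \<bar>b v\<bar> \<le> C * (\<Sum>y\<in>Y. \<bar>blinfun_apply v y\<bar>) + e * norm v"
    by (rule almost_finitely_dependentD[OF FBL_almost_finitely_dependent[OF b] e]) (rule that)
  have "bounded (range (\<lambda>n. blinfun_apply (u n) y))" for y
  proof (rule boundedI)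
    fix z assume "z \<in> range (\<lambda>n. blinfun_apply (u n) y)"
    then obtain n where "z = blinfun_apply (u n) y" by auto
    then show "norm z \<le> K * norm y"
      using norm_blinfun[of "u n" y] mult_right_mono[OF K[of n] norm_ge_zero[of y]] by simp
  qed
  then obtain r :: "nat \<Rightarrow> nat" where r: "strict_mono r"
    and conv: "\<And>y. y \<in> Y \<Longrightarrow> convergent (\<lambda>n. blinfun_apply (u (r n)) y)"
    using common_convergent_subsequence[OF Y(1), of "\<lambda>n. blinfun_apply (u n)"] by blast
  \<comment> \<open>Every \<open>v k\<close> has the value \<open>1\<close> at \<open>x (r k)\<close>, yet \<open>v\<close> tends to \<open>0\<close> on \<open>Y\<close>.\<close>
  define v where "v k = u (r k) - u (r (Suc k))" for k
  have "(\<lambda>k. blinfun_apply (v k) y) \<longlonglongrightarrow> 0" if y: "y \<in> Y" for y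
  proof -
    obtain l where "(\<lambda>k. blinfun_apply (u (r k)) y) \<longlonglongrightarrow> l"
      using conv[OF y] unfolding convergent_def by blast
    from tendsto_diff[OF this LIMSEQ_Suc[OF this]] show ?thesis
      by (simp add: v_def blinfun.diff_left)
  qed
  then have "(\<lambda>k. \<Sum>y\<in>Y. \<bar>blinfun_apply (v k) y\<bar>) \<longlonglongrightarrow> (\<Sum>y\<in>Y. 0)"
    by (intro tendsto_sum tendsto_rabs_zero)
  then have "(\<lambda>k. C * (\<Sum>y\<in>Y. \<bar>blinfun_apply (v k) y\<bar>)) \<longlonglongrightarrow> 0"
    by (intro tendsto_mult_right_zero) simp
  from order_tendstoD(2)[OF this, of "1/2"]
  obtain k where k: "C * (\<Sum>y\<in>Y. \<bar>blinfun_apply (v k) y\<bar>) < 1/2"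
    by (auto simp: eventually_sequentially)
  have "norm (v k) \<le> 2 * K"
    using norm_triangle_ineq4[of "u (r k)" "u (r (Suc k))"] K[of "r k"] K[of "r (Suc k)"]
    by (simp add: v_def)
  then have "e * norm (v k) \<le> e * (2 * K)" using e by simp
  also have "\<dots> < 1/2" using K0 by (simp add: e_def field_simps)
  finally have "\<bar>b (v k)\<bar> < 1" using dep[of "v k"] k by linarith
  moreover have "r k \<noteq> r (Suc k)" using strict_monoD[OF r, of k "Suc k"] by simp
  then have "blinfun_apply (v k) (x (r k)) = 1" by (simp add: v_def blinfun.diff_left bi)
  then have "1 \<le> b (v k)" using above[of "v k" "r k"] by simp
  ultimately show False by simp
qed

text \<open>
  The bound on signed sums makes the sequence \<^term>\<open>sup_abs_deltas x\<close> norm bounded, so the strong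
  Nakano property provides an upper bound in \<^term>\<open>FBL\<close>, which biorthogonality excludes.
\<close>

theorem strong_nakano_no_biorthogonal:
  fixes x :: "nat \<Rightarrow> 'a::real_normed_vector" and u :: "nat \<Rightarrow> 'a \<Rightarrow>\<^sub>L real"
  assumes nakano: "strong_nakano l (FBL :: (('a \<Rightarrow>\<^sub>L real) \<Rightarrow> real) set) fbl_norm"
    and bi: "\<And>m n. blinfun_apply (u n) (x m) = (if m = n then 1 else 0)"
    and K: "\<And>n. norm (u n) \<le> K"
    and wuc: "\<And>N s. (\<forall>n. \<bar>s n\<bar> = 1) \<Longrightarrow> norm (\<Sum>n<N. s n *\<^sub>R x n) \<le> C"
  shows False
proof -
  let ?A = "range (sup_abs_deltas x)"
  have "?A \<subseteq> {a \<in> FBL. 0 \<le> a}"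
    by (auto simp: sup_abs_deltas_in_FBL le_fun_def sup_abs_deltas_nonneg)
  moreover have "?A \<noteq> {}" by simp
  moreover have "bdd_above (fbl_norm ` ?A)"
    using fbl_norm_sup_abs_deltas_le[OF wuc] by (auto intro!: bdd_aboveI[where M = C])
  moreover have "\<forall>a\<in>?A. \<forall>b\<in>?A. \<exists>c\<in>?A. a \<le> c \<and> b \<le> c"
  proof (intro ballI)
    fix a b assume "a \<in> ?A" "b \<in> ?A"
    then obtain m n where "a = sup_abs_deltas x m" "b = sup_abs_deltas x n" by auto
    then show "\<exists>c\<in>?A. a \<le> c \<and> b \<le> c"
      by (intro bexI[of _ "sup_abs_deltas x (max m n)"] conjI) (auto intro: sup_abs_deltas_mono)
  qed
  ultimately have "\<exists>b\<in>FBL. (\<forall>a\<in>?A. a \<le> b) \<and> fbl_norm b \<le> l * (SUP a\<in>?A. fbl_norm a)"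
    by (intro nakano[unfolded strong_nakano_def, THEN spec, THEN mp] conjI)
  then obtain b where b: "b \<in> FBL" "\<And>n. sup_abs_deltas x n \<le> b" by blast
  have "\<bar>blinfun_apply v (x n)\<bar> \<le> b v" for n v
    using le_funD[OF b(2)[of "Suc n"], of v] unfolding sup_abs_deltas_Suc_apply by simp
  then show False
    using biorthogonal_no_upper_bound[OF bi K b(1)] by (simp add: not_less[symmetric])
qed

section \<open>The unit vectors of the space of null sequences\<close>

definition unit_seq :: "nat \<Rightarrow> nat \<Rightarrow>\<^sub>C real" where
  "unit_seq n = Bcontfun (\<lambda>m. if m = n then 1 else 0)"

lemma unit_seq_apply: "apply_bcontfun (unit_seq n) m = (if m = n then 1 else 0)"
proof -
  have "(\<lambda>m::nat. if m = n then 1 else (0::real)) \<in> bcontfun"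
    by (rule bcontfun_normI[where b = 1]) auto
  then show ?thesis by (simp add: unit_seq_def Bcontfun_inverse)
qed

lemma subspace_c0: "subspace c0"
  unfolding subspace_def c0_def
proof (intro conjI ballI allI)
  fix x y :: "nat \<Rightarrow>\<^sub>C real"
  assume "x \<in> {x. apply_bcontfun x \<longlonglongrightarrow> 0}" "y \<in> {x. apply_bcontfun x \<longlonglongrightarrow> 0}"
  then show "x + y \<in> {x. apply_bcontfun x \<longlonglongrightarrow> 0}"
    using tendsto_add[of "apply_bcontfun x" 0 sequentially "apply_bcontfun y" 0]
    by (simp add: plus_bcontfun.rep_eq)
next
  fix c and x :: "nat \<Rightarrow>\<^sub>C real"
  assume "x \<in> {x. apply_bcontfun x \<longlonglongrightarrow> 0}"
  then show "c *\<^sub>R x \<in> {x. apply_bcontfun x \<longlonglongrightarrow> 0}"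
    using tendsto_mult_right_zero[of "apply_bcontfun x" sequentially c]
    by (simp add: scaleR_bcontfun.rep_eq)
qed simp

lemma unit_seq_in_c0: "unit_seq n \<in> c0"
proof -
  have "\<forall>\<^sub>F m in sequentially. apply_bcontfun (unit_seq n) m = 0"
    using eventually_gt_at_top[of n] by eventually_elim (simp add: unit_seq_apply)
  then show ?thesis by (simp add: c0_def tendsto_eventually)
qed

lemma norm_signed_unit_sum_le:
  assumes "\<forall>n. \<bar>s n\<bar> = 1"
  shows "norm (\<Sum>n<N. s n *\<^sub>R unit_seq n) \<le> 1"
proof (rule norm_bound)
  fix m
  have "apply_bcontfun (\<Sum>n<N. s n *\<^sub>R unit_seq n) m = (\<Sum>n<N. if m = n then s n else 0)"
    by (induction N) (auto simp: unit_seq_apply plus_bcontfun.rep_eq scaleR_bcontfun.rep_eq)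
  also have "\<dots> = (if m < N then s m else 0)" by simp
  finally show "norm (apply_bcontfun (\<Sum>n<N. s n *\<^sub>R unit_seq n) m) \<le> 1"
    using assms by simp
qed

text \<open>
  The three properties of the unit vectors of \<open>c\<^sub>0\<close> that survive an isomorphic embedding. The
  functionals are the coordinates composed with the inverse isomorphism, extended from the
  subspace to the whole space.
\<close>

lemma c0_subspace_biorthogonal:
  fixes F :: "'a::real_normed_vector set"
  assumes F: "subspace F" and iso: "isomorphic_subspaces c0 F"
  obtains x :: "nat \<Rightarrow> 'a" and u :: "nat \<Rightarrow> 'a \<Rightarrow>\<^sub>L real" and K C where
    "\<And>m n. blinfun_apply (u n) (x m) = (if m = n then 1 else 0)" "\<And>n. norm (u n) \<le> K"
    "\<And>N s. (\<forall>n. \<bar>s n\<bar> = 1) \<Longrightarrow> norm (\<Sum>n<N. s n *\<^sub>R x n) \<le> C"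
proof -
  obtain T T' where hom: "homeomorphism c0 F T T'"
    and add: "\<And>x y. x \<in> c0 \<Longrightarrow> y \<in> c0 \<Longrightarrow> T (x + y) = T x + T y"
    and scale: "\<And>c x. x \<in> c0 \<Longrightarrow> T (c *\<^sub>R x) = c *\<^sub>R T x"
    using iso unfolding isomorphic_subspaces_def by auto
  have inF: "T x \<in> F" and inv: "T' (T x) = x" if "x \<in> c0" for x
    using hom that by (auto simp: homeomorphism_def)
  have inV: "T' y \<in> c0" and inv': "T (T' y) = y" if "y \<in> F" for y
    using hom that by (auto simp: homeomorphism_def)
  have add': "T' (x + y) = T' x + T' y" if "x \<in> F" "y \<in> F" for x y
    using inv[OF subspace_add[OF subspace_c0 inV[OF that(1)] inV[OF that(2)]]]
    by (simp add: add inV inv' that)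
  have scale': "T' (c *\<^sub>R x) = c *\<^sub>R T' x" if "x \<in> F" for c x
    using inv[OF subspace_scale[OF subspace_c0 inV[OF that]], of c]
    by (simp add: scale inV inv' that)
  obtain C where C: "C > 0" "\<And>x. x \<in> c0 \<Longrightarrow> norm (T x) \<le> C * norm x"
    using linear_continuous_on_subspace_bounded[OF subspace_c0 homeomorphism_cont1[OF hom] scale]
    by blast
  obtain K where K: "K > 0" "\<And>y. y \<in> F \<Longrightarrow> norm (T' y) \<le> K * norm y"
    using linear_continuous_on_subspace_bounded[OF F homeomorphism_cont2[OF hom] scale'] by blast
  have "\<exists>u :: 'a \<Rightarrow>\<^sub>L real. (\<forall>y\<in>F. blinfun_apply u y = apply_bcontfun (T' y) n) \<and> norm u \<le> K" for n
  proof (rule Hahn_Banach_norm_preserving[OF F])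
    show "\<bar>apply_bcontfun (T' y) n\<bar> \<le> K * norm y" if "y \<in> F" for y
      using norm_bounded[of "T' y" n] K(2)[OF that] by simp
  qed (use K(1) in \<open>auto simp: add' scale' plus_bcontfun.rep_eq scaleR_bcontfun.rep_eq\<close>)
  then obtain u :: "nat \<Rightarrow> 'a \<Rightarrow>\<^sub>L real"
    where u: "\<And>n y. y \<in> F \<Longrightarrow> blinfun_apply (u n) y = apply_bcontfun (T' y) n"
      "\<And>n. norm (u n) \<le> K" by metis
  have T0: "T 0 = 0" using scale[OF unit_seq_in_c0, of 0] by simp
  have sum: "(\<Sum>n<N. s n *\<^sub>R unit_seq n) \<in> c0 \<and>
      T (\<Sum>n<N. s n *\<^sub>R unit_seq n) = (\<Sum>n<N. s n *\<^sub>R T (unit_seq n))" for N s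
  proof (induction N)
    case 0
    show ?case using subspace_0[OF subspace_c0] by (simp add: T0)
  next
    case (Suc N)
    then show ?case
      by (simp add: add scale unit_seq_in_c0 subspace_add subspace_scale subspace_c0)
  qed
  show thesis
  proof (rule that[of u "\<lambda>n. T (unit_seq n)" K C])
    show "blinfun_apply (u n) (T (unit_seq m)) = (if m = n then 1 else 0)" for m n
      by (auto simp: u(1) inF inv unit_seq_in_c0 unit_seq_apply)
    show "norm (u n) \<le> K" for n by (rule u(2))
    show "norm (\<Sum>n<N. s n *\<^sub>R T (unit_seq n)) \<le> C" if "\<forall>n. \<bar>s n\<bar> = 1" for N s
    proof -
      have "norm (\<Sum>n<N. s n *\<^sub>R T (unit_seq n)) \<le> C * norm (\<Sum>n<N. s n *\<^sub>R unit_seq n)"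
        using C(2) sum[of s N] by metis
      also have "\<dots> \<le> C * 1" using norm_signed_unit_sum_le[OF that] C(1) by (intro mult_left_mono) auto
      finally show ?thesis by simp
    qed
  qed
qed

theorem proposition3p5:
  fixes l :: real
  assumes "l \<ge> 1"
    and "strong_nakano l (FBL :: (('a::banach \<Rightarrow>\<^sub>L real) \<Rightarrow> real) set) fbl_norm"
  shows "\<not> (\<exists>F :: 'a set. subspace F \<and> isomorphic_subspaces c0 F)"
proof
  assume "\<exists>F :: 'a set. subspace F \<and> isomorphic_subspaces c0 F"
  then obtain F :: "'a set" where "subspace F" "isomorphic_subspaces c0 F" by blast
  then show False
    using strong_nakano_no_biorthogonal[OF assms(2)] by (rule c0_subspace_biorthogonal)
qed

end
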